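(* Let $S_{\mathrm A} = \bigcup_{k \ge 2,\ k \text{ even}} \left((2^{k-1}, 2^k] \cap \mathbb{Z}^+\right)$. If the order gadget $\mathrm{OG}(2^{2t-1})$ is infeasible for infinitely many integers $t \ge 4$, then $S_{\mathrm A}$ is not $3$-permutable.
   Context: $\mathbb{N} = \{1,2,3,\dots\} = \mathbb{Z}^+$. A set $S \subseteq \mathbb{Z}^+$ is $3$-permutable if there is a bijection $\pi\colon \mathbb{N} \to S$ such that no $i<j<k$ have $\pi(i),\pi(j),\pi(k)$ forming an arithmetic progression with $\pi(i)<\pi(j)<\pi(k)$ or $\pi(i)>\pi(j)>\pi(k)$. For an integer $M \ge 16$, the order gadget $\mathrm{OG}(M)$ asks for a linear order $\prec$ of the integer interval $(M,2M] = \{M+1,\dots,2M\}$ such that: (i) for every arithmetic progression $a<b<c$ inside $(M,2M]$, neither $a \prec b \prec c$ nor $c \prec b \prec a$ holds; and (ii) for each $x \in \{15,16\}$ and each integer $j$ with $1 \le j \le x/2$, the element $2M+2j-x$ precedes the element $M+j$, i.e. $2M+2j-x \prec M+j$. $\mathrm{OG}(M)$ is infeasible if no such order exists. *)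

theory Defs
  imports Main
begin

definition increasing_AP3 :: "nat \<Rightarrow> nat \<Rightarrow> nat \<Rightarrow> bool" where
  "increasing_AP3 a b c \<longleftrightarrow> a < b \<and> b < c \<and> a + c = 2 * b"

text \<open>Meant for sets of positive integers. A permutation is indexed by the positive integers.\<close>

definition three_permutable :: "nat set \<Rightarrow> bool" where
  "three_permutable S \<longleftrightarrow>
    (\<exists>\<pi>. bij_betw \<pi> {1::nat..} S \<and>
      (\<forall>i j k. 1 \<le> i \<and> i < j \<and> j < k \<longrightarrow>
        \<not> increasing_AP3 (\<pi> i) (\<pi> j) (\<pi> k) \<and>
        \<not> increasing_AP3 (\<pi> k) (\<pi> j) (\<pi> i)))"

definition strict_linear_order_of :: "'a set \<Rightarrow> ('a \<times> 'a) set \<Rightarrow> bool" where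
  "strict_linear_order_of A r \<longleftrightarrow> r \<subseteq> A \<times> A \<and> strict_linear_order_on A r"

text \<open>
  Here \<open>(a, b) \<in> r\<close> means that a precedes b. The gadget is only used for M at least 16;
  then the natural subtraction in the second condition does not truncate, and both elements
  mentioned there lie in the interval.
\<close>

definition order_gadget_solution :: "nat \<Rightarrow> (nat \<times> nat) set \<Rightarrow> bool" where
  "order_gadget_solution M r \<longleftrightarrow>
    strict_linear_order_of {M<..2 * M} r \<and>
    (\<forall>a\<in>{M<..2 * M}. \<forall>b\<in>{M<..2 * M}. \<forall>c\<in>{M<..2 * M}. increasing_AP3 a b c \<longrightarrow>
      \<not> ((a, b) \<in> r \<and> (b, c) \<in> r) \<and> \<not> ((c, b) \<in> r \<and> (b, a) \<in> r)) \<and>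
    (\<forall>x\<in>{15, 16}. \<forall>j. 1 \<le> j \<and> 2 * j \<le> x \<longrightarrow> (2 * M + 2 * j - x, M + j) \<in> r)"

definition order_gadget_infeasible :: "nat \<Rightarrow> bool" where
  "order_gadget_infeasible M \<longleftrightarrow> \<not> (\<exists>r. order_gadget_solution M r)"

definition S_A :: "nat set" where
  "S_A = (\<Union>k\<in>{k. 2 \<le> k \<and> even k}. {2 ^ (k - 1)<..2 ^ k})"

end

theory Submission
  imports Defs
begin

text \<open>
  Only finitely many elements precede 15 or 16, so all sufficiently late blocks of \<open>S_A\<close> lie
  entirely after both. In such a block \<open>(M, 2M]\<close>, the progressions
  \<open>x < M + j < 2M + 2j - x\<close> with \<open>x \<in> {15, 16}\<close> then force
  \<open>2M + 2j - x\<close> to precede \<open>M + j\<close>, so the order induced on the block solves the gadget.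
\<close>

lemma strict_linear_order_of_inj_on:
  fixes f :: "'a \<Rightarrow> 'b::linorder"
  assumes "inj_on f A"
  shows "strict_linear_order_of A {(a, b). a \<in> A \<and> b \<in> A \<and> f a < f b}"
  using assms
  by (auto simp: strict_linear_order_of_def strict_linear_order_on_def trans_def irrefl_def
      total_on_def inj_on_def not_less order.order_iff_strict)

text \<open>Replaces the enumeration by its inverse, the position function \<open>f\<close>.
  Precedence becomes comparison of \<open>f\<close>-values, which restricts directly to a
  block.\<close>

lemma three_permutable_positionE:
  assumes "three_permutable S"
  obtains f where "bij_betw f S {1::nat..}"
    and "\<And>a b c. a \<in> S \<Longrightarrow> b \<in> S \<Longrightarrow> c \<in> S \<Longrightarrow> increasing_AP3 a b c \<Longrightarrow>
      \<not> (f a < f b \<and> f b < f c) \<and> \<not> (f c < f b \<and> f b < f a)"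
proof -
  obtain \<pi> where bij: "bij_betw \<pi> {1::nat..} S"
    and avoid: "\<And>i j k. 1 \<le> i \<Longrightarrow> i < j \<Longrightarrow> j < k \<Longrightarrow>
      \<not> increasing_AP3 (\<pi> i) (\<pi> j) (\<pi> k) \<and> \<not> increasing_AP3 (\<pi> k) (\<pi> j) (\<pi> i)"
    using assms unfolding three_permutable_def by blast
  define f where "f = the_inv_into {1..} \<pi>"
  have f: "bij_betw f S {1..}"
    unfolding f_def by (rule bij_betw_the_inv_into[OF bij])
  have pi_f: "\<pi> (f a) = a" if "a \<in> S" for a
    unfolding f_def using f_the_inv_into_f_bij_betw[OF bij] that by blast
  \<comment> \<open>The avoidance property only speaks of indices from 1 on.\<close>
  have "1 \<le> f a" if "a \<in> S" for a
    using bij_betwE[OF f] that by auto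
  then show thesis
    using that[OF f] avoid pi_f by metis
qed

text \<open>The index \<open>k = 2 * t\<close> of the union, with its upper end written as twice the
  lower one to match the gadget's interval.\<close>

lemma S_A_block_subset:
  assumes "1 \<le> t"
  shows "{2 ^ (2 * t - 1)<..2 * 2 ^ (2 * t - 1)} \<subseteq> S_A"
proof -
  have "(2::nat) * 2 ^ (2 * t - 1) = 2 ^ (2 * t)"
    using assms by (simp flip: power_Suc)
  then show ?thesis
    using assms unfolding S_A_def by (intro subsetI UN_I[of "2 * t"]) auto
qed

lemma order_gadget_solution_if_late_block:
  fixes f :: "nat \<Rightarrow> 'a::linorder"
  assumes M: "16 \<le> M" and S: "{M<..2 * M} \<subseteq> S" "15 \<in> S" "16 \<in> S" and inj: "inj_on f S"
    and avoid: "\<And>a b c. a \<in> S \<Longrightarrow> b \<in> S \<Longrightarrow> c \<in> S \<Longrightarrow> increasing_AP3 a b c \<Longrightarrow>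
      \<not> (f a < f b \<and> f b < f c) \<and> \<not> (f c < f b \<and> f b < f a)"
    and late: "\<And>b. b \<in> {M<..2 * M} \<Longrightarrow> f 15 < f b \<and> f 16 < f b"
  shows "order_gadget_solution M
    {(a, b). a \<in> {M<..2 * M} \<and> b \<in> {M<..2 * M} \<and> f a < f b}"
    (is "order_gadget_solution M ?r")
proof -
  have "(2 * M + 2 * j - x, M + j) \<in> ?r"
    if x: "x \<in> {15, 16}" and j: "1 \<le> j" "2 * j \<le> x" for x j
  proof -
    define b c where "b = M + j" and "c = 2 * M + 2 * j - x"
    \<comment> \<open>\<open>2 * j \<le> x\<close> keeps \<open>c\<close> at most
      \<open>2 * M\<close>, and \<open>x \<le> 16 \<le> M\<close> gives both \<open>M < c\<close>
      and \<open>x < b < c\<close>.\<close>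
    have bc: "b \<in> {M<..2 * M}" "c \<in> {M<..2 * M}" "increasing_AP3 x b c"
      using x j M by (auto simp: b_def c_def increasing_AP3_def)
    have "f x < f b" "x \<in> S"
      using late[OF bc(1)] x S by auto
    then have "\<not> f b < f c"
      using avoid[of x b c] bc S(1) by blast
    \<comment> \<open>Avoidance only excludes \<open>f b < f c\<close>; injectivity excludes a tie,
      so \<open>c\<close> precedes \<open>b\<close>.\<close>
    moreover have "f b \<noteq> f c"
      using inj_on_subset[OF inj S(1)] bc by (auto simp: increasing_AP3_def inj_on_eq_iff)
    ultimately show ?thesis
      using bc unfolding b_def c_def by auto
  qed
  moreover have "strict_linear_order_of {M<..2 * M} ?r"
    using strict_linear_order_of_inj_on inj_on_subset[OF inj S(1)] by blast
  moreover have "\<not> ((a, b) \<in> ?r \<and> (b, c) \<in> ?r) \<and> \<not> ((c, b) \<in> ?r \<and> (b, a) \<in> ?r)"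
    if "a \<in> {M<..2 * M}" "b \<in> {M<..2 * M}" "c \<in> {M<..2 * M}" "increasing_AP3 a b c" for a b c
    using avoid[of a b c] that S(1) by blast
  ultimately show ?thesis
    unfolding order_gadget_solution_def by blast
qed

theorem theorem16:
  assumes "infinite {t::nat. 4 \<le> t \<and> order_gadget_infeasible (2 ^ (2 * t - 1))}"
  shows "\<not> three_permutable S_A"
proof
  assume "three_permutable S_A"
  then obtain f where bij: "bij_betw f S_A {1::nat..}"
    and avoid: "\<And>a b c. a \<in> S_A \<Longrightarrow> b \<in> S_A \<Longrightarrow> c \<in> S_A \<Longrightarrow> increasing_AP3 a b c \<Longrightarrow>
      \<not> (f a < f b \<and> f b < f c) \<and> \<not> (f c < f b \<and> f b < f a)"
    by (erule three_permutable_positionE)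
  have inj: "inj_on f S_A"
    using bij by (rule bij_betw_imp_inj_on)
  \<comment> \<open>By position \<open>N\<close> both 15 and 16 have occurred. Only finitely many
    elements have a position up to \<open>N\<close>, so their values have a common bound
    \<open>B\<close>.\<close>
  define N where "N = max (f 15) (f 16)"
  have "finite (f -` {..N} \<inter> S_A)"
    using inj by (intro finite_vimage_IntI) auto
  then obtain B where B: "\<And>b. b \<in> S_A \<Longrightarrow> f b \<le> N \<Longrightarrow> b \<le> B"
    unfolding finite_nat_set_iff_bounded_le by auto
  obtain t where t: "B < t" "4 \<le> t" "order_gadget_infeasible (2 ^ (2 * t - 1))"
    using assms unfolding finite_nat_set_iff_bounded_le by (auto simp: not_le)
  define M :: nat where "M = 2 ^ (2 * t - 1)"
  \<comment> \<open>With \<open>B < t \<le> 2 * t - 1\<close> this puts the whole block above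
    \<open>B\<close>.\<close>
  have "2 * t - 1 < M"
    unfolding M_def by (rule less_exp)
  then have "B < M"
    using t by linarith
  have "(2::nat) ^ 4 \<le> M"
    unfolding M_def using t by (intro power_increasing) auto
  then have "16 \<le> M"
    by simp
  have block: "{M<..2 * M} \<subseteq> S_A"
    unfolding M_def using t by (intro S_A_block_subset) simp
  have "f 15 < f b \<and> f 16 < f b" if "b \<in> {M<..2 * M}" for b
  proof -
    have "b \<in> S_A" "\<not> b \<le> B"
      using that block \<open>B < M\<close> by auto
    then have "N < f b"
      using B not_le by blast
    then show ?thesis
      by (simp add: N_def)
  qed
  \<comment> \<open>Both lie in the block from 9 to 16, the case \<open>t = 2\<close>.\<close>
  moreover have "15 \<in> S_A" "16 \<in> S_A"
    using S_A_block_subset[of 2] by auto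
  ultimately have "\<exists>r. order_gadget_solution M r"
    using order_gadget_solution_if_late_block[OF \<open>16 \<le> M\<close> block _ _ inj avoid] by blast
  then show False
    using t(3) unfolding order_gadget_infeasible_def M_def by blast
qed

end
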